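(* Let $\mathcal A$ be a unital $C^*$-algebra and let $A,B\in\mathcal A^{++}$. If $A\,\sigma_{ch}\,B=A\,\sigma_w\,B$, then $AB=BA$.
   Context: $\mathcal A^{++}$ denotes the set of all positive invertible elements of the unital $C^*$-algebra $\mathcal A$. For $A,B\in\mathcal A^{++}$: the Kubo-Ando geometric mean is $A\# B=A^{1/2}(A^{-1/2}BA^{-1/2})^{1/2}A^{1/2}$; the conventional Heron mean is $A\,\sigma_{ch}\,B=\left(\frac{A^{1/2}+B^{1/2}}{2}\right)^2$; the Wasserstein mean is $A\,\sigma_w\,B=\frac14\bigl(A+B+A(A^{-1}\# B)+(A^{-1}\# B)A\bigr)$. *)

theory Defs
  imports Complex_Main "HOL-Library.Nonpos_Ints"
begin

text \<open>
  Nonzero unital \<open>C\<^sup>*\<close>-algebras as a type class. The base classes \<open>real_normed_algebra_1\<close> and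
  \<open>banach\<close> supply a complete, submultiplicative norm with \<open>norm 1 = 1\<close>, which holds in
  every unital \<open>C\<^sup>*\<close>-algebra with \<open>1 \<noteq> 0\<close>; \<open>scaleC\<close> extends their real scalar multiplication.
\<close>

class cstar_algebra = real_normed_algebra_1 + banach +
  fixes scaleC :: "complex \<Rightarrow> 'a \<Rightarrow> 'a"  (infixr \<open>*\<^sub>C\<close> 75)
    and adj :: "'a \<Rightarrow> 'a"
  assumes scaleC_of_real: "complex_of_real r *\<^sub>C x = r *\<^sub>R x"
    and scaleC_add_right: "c *\<^sub>C (x + y) = c *\<^sub>C x + c *\<^sub>C y"
    and scaleC_add_left: "(c + d) *\<^sub>C x = c *\<^sub>C x + d *\<^sub>C x"
    and scaleC_scaleC: "c *\<^sub>C d *\<^sub>C x = (c * d) *\<^sub>C x"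
    and mult_scaleC_left: "(c *\<^sub>C x) * y = c *\<^sub>C (x * y)"
    and mult_scaleC_right: "x * (c *\<^sub>C y) = c *\<^sub>C (x * y)"
    and norm_scaleC: "norm (c *\<^sub>C x) = cmod c * norm x"
    and adj_add: "adj (x + y) = adj x + adj y"
    and adj_scaleC: "adj (c *\<^sub>C x) = cnj c *\<^sub>C adj x"
    and adj_mult: "adj (x * y) = adj y * adj x"
    and adj_adj: "adj (adj x) = x"
    and cstar_identity: "norm (adj x * x) = (norm x)\<^sup>2"

definition cstar_invertible :: "'a::cstar_algebra \<Rightarrow> bool" where
  "cstar_invertible a \<longleftrightarrow> (\<exists>b. a * b = 1 \<and> b * a = 1)"

definition cstar_inv :: "'a::cstar_algebra \<Rightarrow> 'a" where
  "cstar_inv a = (THE b. a * b = 1 \<and> b * a = 1)"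

definition cstar_spectrum :: "'a::cstar_algebra \<Rightarrow> complex set" where
  "cstar_spectrum a = {c. \<not> cstar_invertible (c *\<^sub>C 1 - a)}"

definition cstar_positive :: "'a::cstar_algebra \<Rightarrow> bool" where
  "cstar_positive a \<longleftrightarrow> adj a = a \<and> cstar_spectrum a \<subseteq> \<real>\<^sub>\<ge>\<^sub>0"

definition cstar_pos_invertibles :: "'a::cstar_algebra set" where
  "cstar_pos_invertibles = {a. cstar_positive a \<and> cstar_invertible a}"

text \<open>
  \<open>A\<^sup>1\<^sup>/\<^sup>2\<close> is the unique positive square root of \<open>A\<close>; the definition is meaningful only for
  positive arguments. Below, \<open>A\<^sup>-\<^sup>1\<^sup>/\<^sup>2\<close> is the inverse of \<open>A\<^sup>1\<^sup>/\<^sup>2\<close>.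
\<close>

definition cstar_sqrt :: "'a::cstar_algebra \<Rightarrow> 'a" where
  "cstar_sqrt a = (THE b. cstar_positive b \<and> b * b = a)"

definition geometric_mean :: "'a::cstar_algebra \<Rightarrow> 'a \<Rightarrow> 'a" where
  "geometric_mean A B =
     cstar_sqrt A
       * cstar_sqrt (cstar_inv (cstar_sqrt A) * B * cstar_inv (cstar_sqrt A))
       * cstar_sqrt A"

definition conventional_heron_mean :: "'a::cstar_algebra \<Rightarrow> 'a \<Rightarrow> 'a" where
  "conventional_heron_mean A B = ((1/2) *\<^sub>R (cstar_sqrt A + cstar_sqrt B))\<^sup>2"

definition wasserstein_mean :: "'a::cstar_algebra \<Rightarrow> 'a \<Rightarrow> 'a" where
  "wasserstein_mean A B =
     (1/4) *\<^sub>R (A + B + A * geometric_mean (cstar_inv A) B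
                    + geometric_mean (cstar_inv A) B * A)"

end

theory Submission
  imports Defs "HOL-Analysis.Analysis"
begin

text \<open>
  Write \<open>a = A\<^sup>1\<^sup>/\<^sup>2\<close>, \<open>b = B\<^sup>1\<^sup>/\<^sup>2\<close> and \<open>G = A\<^sup>-\<^sup>1 # B\<close>, so that \<open>G A G = B\<close>. Equality of the means says
  that \<open>Z = a b - A G\<close> is skew-adjoint, and then \<open>G Z - Z G = Z A\<^sup>-\<^sup>1 Z\<close>. Thus
  \<open>Z G - G Z = Z A\<^sup>-\<^sup>1 Z\<^sup>*\<close> is positive: conjugation by powers of the unitary Cayley transform of \<open>Z\<close>
  would make \<open>G\<close> grow linearly without changing its norm, unless \<open>Z = 0\<close>. So \<open>a b = A G\<close>, hence
  \<open>b = a G\<close>; taking adjoints, \<open>a\<close> commutes with \<open>G\<close>, and therefore with \<open>b\<close>.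
\<close>

subsection \<open>Scalars and the involution\<close>

lemma scaleC_1 [simp]: "1 *\<^sub>C x = (x::'a::cstar_algebra)"
  using scaleC_of_real[of 1 x] by simp

lemma scaleC_0 [simp]: "0 *\<^sub>C x = (0::'a::cstar_algebra)"
  using scaleC_of_real[of 0 x] by simp

lemma scaleC_minus_left: "(- c) *\<^sub>C x = - (c *\<^sub>C (x::'a::cstar_algebra))"
  using scaleC_add_left[of c "- c" x] by (simp add: add_eq_0_iff)

lemma scaleC_minus_right: "c *\<^sub>C (- x) = - (c *\<^sub>C (x::'a::cstar_algebra))"
  using scaleC_add_left[of c "- c" x] scaleC_scaleC[of c "-1" x] scaleC_minus_left[of 1 x]
  by (simp add: scaleC_minus_left)

lemma scaleC_diff_right: "c *\<^sub>C (x - y) = c *\<^sub>C x - c *\<^sub>C (y::'a::cstar_algebra)"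
  using scaleC_add_right[of c x "- y"] by (simp add: scaleC_minus_right)

lemma scaleC_diff_left: "(c - d) *\<^sub>C x = c *\<^sub>C x - d *\<^sub>C (x::'a::cstar_algebra)"
  using scaleC_add_left[of c "- d" x] by (simp add: scaleC_minus_left)

lemma scaleC_of_real_1: "complex_of_real r *\<^sub>C 1 = (of_real r :: 'a::cstar_algebra)"
  by (simp add: scaleC_of_real scaleR_conv_of_real)

lemma adj_1 [simp]: "adj (1::'a::cstar_algebra) = 1"
  by (metis adj_adj adj_mult mult.right_neutral)

lemma adj_scaleR [simp]: "adj (r *\<^sub>R x) = r *\<^sub>R adj (x::'a::cstar_algebra)"
  by (metis adj_scaleC complex_cnj_complex_of_real scaleC_of_real)

lemma adj_0 [simp]: "adj (0::'a::cstar_algebra) = 0"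
  using adj_scaleR[of 0 "0::'a"] by simp

lemma adj_of_real [simp]: "adj (of_real r :: 'a::cstar_algebra) = of_real r"
  by (simp add: of_real_def)

lemma adj_minus [simp]: "adj (- x) = - adj (x::'a::cstar_algebra)"
  using adj_scaleR[of "-1" x] by simp

lemma adj_diff: "adj (x - y) = adj x - adj (y::'a::cstar_algebra)"
  using adj_add[of x "- y"] by simp

text \<open>The C*-identity and submultiplicativity bound the squared norm of \<open>y\<close> by
  \<open>norm (adj y) * norm y\<close>. Cancelling \<open>norm y\<close>, then taking
  \<open>y = x\<close> and \<open>y = adj x\<close>, gives both inequalities.\<close>

lemma norm_adj [simp]: "norm (adj x) = norm (x::'a::cstar_algebra)"
proof (rule antisym)
  have *: "norm y \<le> norm (adj y)" for y :: 'a
  proof (cases "norm y = 0")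
    case False
    have "norm y * norm y \<le> norm (adj y) * norm y"
      using cstar_identity[of y] norm_mult_ineq[of "adj y" y] by (simp add: power2_eq_square)
    then show ?thesis using False by (simp add: mult_le_cancel_right)
  qed simp
  show "norm x \<le> norm (adj x)" by (rule *)
  show "norm (adj x) \<le> norm x" using *[of "adj x"] by (simp add: adj_adj)
qed

lemma norm_square_selfadjoint:
  fixes a :: "'a::cstar_algebra"
  assumes "adj a = a"
  shows "norm (a * a) = (norm a)\<^sup>2"
  using cstar_identity[of a] assms by simp

subsection \<open>Inverses\<close>

lemma cstar_inv_eqI:
  assumes "a * b = (1::'a::cstar_algebra)" "b * a = 1"
  shows "cstar_inv a = b"
  unfolding cstar_inv_def using assms by (intro the_equality) (auto, metis mult.assoc mult.left_neutral mult.right_neutral)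

lemma cstar_invertibleI:
  assumes "a * b = (1::'a::cstar_algebra)" "b * a = 1"
  shows "cstar_invertible a"
  using assms by (auto simp: cstar_invertible_def)

lemma
  assumes "cstar_invertible (a::'a::cstar_algebra)"
  shows cstar_inv_right: "a * cstar_inv a = 1"
    and cstar_inv_left: "cstar_inv a * a = 1"
  using assms cstar_inv_eqI unfolding cstar_invertible_def by metis+

lemma cstar_inv_right_assoc:
  assumes "cstar_invertible (a::'a::cstar_algebra)"
  shows "a * (cstar_inv a * x) = x"
  by (simp add: cstar_inv_right[OF assms] flip: mult.assoc)

lemma cstar_inv_left_assoc:
  assumes "cstar_invertible (a::'a::cstar_algebra)"
  shows "cstar_inv a * (a * x) = x"
  by (simp add: cstar_inv_left[OF assms] flip: mult.assoc)

lemmas cstar_inv_simps = cstar_inv_right cstar_inv_left cstar_inv_right_assoc cstar_inv_left_assoc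

lemma cstar_invertible_mult:
  assumes "cstar_invertible a" "cstar_invertible (b::'a::cstar_algebra)"
  shows "cstar_invertible (a * b)"
  by (rule cstar_invertibleI[where b = "cstar_inv b * cstar_inv a"])
    (simp_all add: cstar_inv_simps assms mult.assoc)

lemma cstar_invertible_inv:
  assumes "cstar_invertible (a::'a::cstar_algebra)"
  shows "cstar_invertible (cstar_inv a)"
  using assms cstar_inv_left cstar_inv_right cstar_invertibleI by blast

lemma cstar_invertible_scaleC:
  assumes "cstar_invertible (a::'a::cstar_algebra)" "c \<noteq> 0"
  shows "cstar_invertible (c *\<^sub>C a)"
  by (rule cstar_invertibleI[where b = "inverse c *\<^sub>C cstar_inv a"])
    (use assms in \<open>simp_all add: mult_scaleC_left mult_scaleC_right scaleC_scaleC cstar_inv_simps\<close>)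

lemma cstar_invertible_minus:
  assumes "cstar_invertible (a::'a::cstar_algebra)"
  shows "cstar_invertible (- a)"
  using cstar_invertible_scaleC[OF assms, of "-1"] by (simp add: scaleC_minus_left)

lemma cstar_inv_diff:
  assumes "cstar_invertible a" "cstar_invertible (b::'a::cstar_algebra)"
  shows "cstar_inv a - cstar_inv b = cstar_inv a * (b - a) * cstar_inv b"
  by (simp add: left_diff_distrib right_diff_distrib mult.assoc cstar_inv_simps assms)

lemma adj_cstar_inv:
  assumes "cstar_invertible (a::'a::cstar_algebra)"
  shows "adj (cstar_inv a) = cstar_inv (adj a)"
  using assms by (intro cstar_inv_eqI[symmetric]) (simp_all add: cstar_inv_simps flip: adj_mult)

section \<open>Neumann series and perturbation of inverses\<close>

lemma cstar_invertible_one_minus: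
  fixes x :: "'a::cstar_algebra"
  assumes "norm x < 1"
  shows "cstar_invertible (1 - x)"
proof -
  have s: "summable (\<lambda>n. x ^ n)"
    using assms by (rule complete_algebra_summable_geometric)
  define S where "S = (\<Sum>n. x ^ n)"
  have e: "S = 1 + (\<Sum>n. x ^ Suc n)"
    using suminf_split_head[OF s] by (simp add: S_def)
  have "(\<Sum>n. x ^ Suc n) = x * S"
    by (simp add: S_def suminf_mult[OF s])
  moreover have "(\<Sum>n. x ^ Suc n) = S * x"
    unfolding S_def suminf_mult2[OF s] by (simp only: power_Suc2)
  ultimately have "S = 1 + x * S" "S = 1 + S * x" using e by simp_all
  then show ?thesis
    by (intro cstar_invertibleI[where b = S]) (simp_all add: algebra_simps)
qed

text \<open>Writing \<open>s\<close> times the inverse as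
  \<open>(of_real s - a) * cstar_inv a + 1\<close> gives \<open>s * N \<le> q * N + 1\<close> for
  the norm \<open>N\<close> of the inverse.\<close>

lemma norm_inv_le:
  fixes a :: "'a::cstar_algebra"
  assumes "cstar_invertible a" "norm (of_real s - a) \<le> q" "q < s"
  shows "norm (cstar_inv a) \<le> 1 / (s - q)"
proof -
  let ?x = "cstar_inv a"
  have "0 \<le> q" using assms(2) norm_ge_zero order_trans by blast
  have "s * norm ?x = norm (of_real s * ?x)"
    using assms \<open>0 \<le> q\<close> by (simp add: of_real_def)
  also have "of_real s * ?x = (of_real s - a) * ?x + 1"
    using assms by (simp add: algebra_simps cstar_inv_simps)
  also have "norm \<dots> \<le> norm ((of_real s - a) * ?x) + norm (1::'a)"
    by (rule norm_triangle_ineq)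
  also have "\<dots> \<le> q * norm ?x + 1"
    using norm_mult_ineq[of "of_real s - a" ?x] mult_right_mono[OF assms(2), of "norm ?x"] by simp
  finally show ?thesis using assms by (simp add: field_simps)
qed

text \<open>Factor \<open>w = x * (1 - d)\<close> with \<open>norm d \<le> 1/2\<close>, so the
  Neumann series applies. In \<open>cstar_inv w = cstar_inv x + d * cstar_inv w\<close> the last
  term is absorbed into the left side, which costs the factor 2.\<close>

lemma cstar_invertible_near:
  fixes x w :: "'a::cstar_algebra"
  assumes "cstar_invertible x" "norm (w - x) * norm (cstar_inv x) \<le> 1/2"
  shows "cstar_invertible w" "norm (cstar_inv w) \<le> 2 * norm (cstar_inv x)"
proof -
  let ?y = "cstar_inv x"
  define d where "d = ?y * (x - w)"
  have nd: "norm d \<le> 1/2"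
    using norm_mult_ineq[of ?y "x - w"] assms(2) by (simp add: d_def norm_minus_commute mult.commute)
  have w: "w = x * (1 - d)"
    using assms(1) by (simp add: d_def algebra_simps cstar_inv_simps)
  show iw: "cstar_invertible w"
    unfolding w using nd by (intro cstar_invertible_mult assms(1) cstar_invertible_one_minus) simp
  have "cstar_inv w = ?y + d * cstar_inv w"
    using iw assms(1) by (simp add: d_def algebra_simps cstar_inv_simps)
  then have "norm (cstar_inv w) \<le> norm ?y + norm (d * cstar_inv w)"
    by (metis norm_triangle_ineq)
  also have "norm (d * cstar_inv w) \<le> 1/2 * norm (cstar_inv w)"
    using norm_mult_ineq[of d "cstar_inv w"] mult_right_mono[OF nd, of "norm (cstar_inv w)"] by simp
  finally show "norm (cstar_inv w) \<le> 2 * norm ?y" by simp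
qed

subsection \<open>Spectra of self-adjoint elements\<close>

lemma spectrum_norm_le:
  fixes a :: "'a::cstar_algebra"
  assumes "c \<in> cstar_spectrum a"
  shows "cmod c \<le> norm a"
proof (rule ccontr)
  assume n: "\<not> cmod c \<le> norm a"
  then have c: "c \<noteq> 0" by auto
  have "norm (inverse c *\<^sub>C a) < 1"
    using n c by (simp add: norm_scaleC norm_inverse inverse_eq_divide norm_divide divide_simps)
  then have "cstar_invertible (c *\<^sub>C (1 - inverse c *\<^sub>C a))"
    by (intro cstar_invertible_scaleC cstar_invertible_one_minus c)
  then show False
    using assms c by (simp add: cstar_spectrum_def scaleC_diff_right scaleC_scaleC)
qed

text \<open>Arens' shift: moving \<open>a\<close> and \<open>c\<close> by the imaginary scalar
  \<open>d = i t\<close> adds exactly \<open>t^2\<close> to the bound for the squared norm of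
  \<open>a\<close>, but \<open>t^2 + 2 t Im c\<close> to the squared modulus of \<open>c\<close>.
  The \<open>t^2\<close> cancels and the linear term is free to exceed any bound.\<close>

lemma selfadjoint_spectrum_real:
  fixes a :: "'a::cstar_algebra"
  assumes "adj a = a" "c \<in> cstar_spectrum a"
  shows "Im c = 0"
proof (rule ccontr)
  assume im: "Im c \<noteq> 0"
  \<comment> \<open>Chosen so that \<open>2 * Im c * t\<close> exceeds the squared norm of
    \<open>a\<close> by 1.\<close>
  define t where "t = ((norm a)\<^sup>2 + 1) / (2 * Im c)"
  define d where "d = Complex 0 t"
  define w where "w = a + d *\<^sub>C 1"
  have "(c + d) *\<^sub>C 1 - w = c *\<^sub>C 1 - a"
    by (simp add: w_def scaleC_add_left)
  then have "c + d \<in> cstar_spectrum w"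
    using assms(2) by (simp add: cstar_spectrum_def)
  then have "(cmod (c + d))\<^sup>2 \<le> (norm w)\<^sup>2"
    by (intro power_mono spectrum_norm_le) auto
  also have "(norm w)\<^sup>2 = norm (adj w * w)" by (simp add: cstar_identity)
  also have "adj w * w = a * a + (cnj d + d) *\<^sub>C a + (cnj d * d) *\<^sub>C 1"
    using assms(1)
    by (simp add: w_def adj_add adj_scaleC algebra_simps mult_scaleC_left mult_scaleC_right
        scaleC_scaleC scaleC_add_left scaleC_add_right)
  also have "cnj d + d = 0" by (simp add: d_def complex_eq_iff)
  also have "cnj d * d = complex_of_real (t\<^sup>2)" by (simp add: d_def complex_eq_iff power2_eq_square)
  also have "norm (a * a + 0 *\<^sub>C a + complex_of_real (t\<^sup>2) *\<^sub>C 1) \<le> norm (a * a) + norm (complex_of_real (t\<^sup>2) *\<^sub>C (1::'a))"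
    using norm_triangle_ineq[of "a * a"] by simp
  also have "\<dots> = (norm a)\<^sup>2 + t\<^sup>2"
    by (simp add: norm_square_selfadjoint[OF assms(1)] norm_scaleC norm_power)
  also have "(cmod (c + d))\<^sup>2 = (Re c)\<^sup>2 + (Im c)\<^sup>2 + 2 * Im c * t + t\<^sup>2"
    unfolding cmod_power2 by (simp add: d_def power2_eq_square algebra_simps)
  also have "2 * Im c * t = (norm a)\<^sup>2 + 1"
    using im by (simp add: t_def)
  finally show False using zero_le_power2[of "Re c"] zero_le_power2[of "Im c"] by linarith
qed

text \<open>Near each point of the closed unit disc the norm of the inverse at most doubles; by
  compactness finitely many such neighbourhoods cover the disc.\<close>

lemma resolvent_bounded:
  fixes k :: "'a::cstar_algebra"
  assumes "\<And>z. cmod z \<le> 1 \<Longrightarrow> cstar_invertible (1 - z *\<^sub>C k)"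
  obtains D where "\<And>z. cmod z \<le> 1 \<Longrightarrow> norm (cstar_inv (1 - z *\<^sub>C k)) \<le> D"
proof -
  define N where "N z = norm (cstar_inv (1 - z *\<^sub>C k))" for z
  \<comment> \<open>The radius keeps the perturbation times \<open>N z\<close> below 1/2, as
    \<open>cstar_invertible_near\<close> demands; the added ones keep the denominator
    positive.\<close>
  define e where "e z = 1 / (2 * (N z + 1) * (norm k + 1))" for z
  have N0: "0 \<le> N z" for z by (simp add: N_def)
  have e0: "e z > 0" for z
    unfolding e_def using N0[of z] by (intro divide_pos_pos mult_pos_pos) (auto intro: add_nonneg_pos)
  have near: "N w \<le> 2 * N z" if z: "cmod z \<le> 1" and w: "w \<in> ball z (e z)" for z w
  proof -
    have "norm ((1 - w *\<^sub>C k) - (1 - z *\<^sub>C k)) = cmod (z - w) * norm k"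
      by (simp add: norm_scaleC flip: scaleC_diff_left)
    also have "\<dots> * N z \<le> (e z * (norm k + 1)) * (N z + 1)"
      using w N0[of z] e0[of z] by (intro mult_mono) (auto simp: dist_norm)
    also have "\<dots> = 1/2"
      using N0[of z] norm_ge_zero[of k] by (simp add: e_def divide_simps add_nonneg_eq_0_iff)
    finally show ?thesis
      unfolding N_def using cstar_invertible_near(2)[OF assms[OF z], of "1 - w *\<^sub>C k"] by blast
  qed
  have "cball 0 1 \<subseteq> (\<Union>z\<in>cball 0 1. ball z (e z))" using e0 by force
  then obtain F where F: "F \<subseteq> cball 0 1" "finite F" "cball 0 1 \<subseteq> (\<Union>z\<in>F. ball z (e z))"
    using compactE_image[OF compact_cball, of "cball 0 1" "\<lambda>z. ball z (e z)" 0 1] by auto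
  have "N w \<le> (\<Sum>z\<in>F. 2 * N z)" if "cmod w \<le> 1" for w
  proof -
    have "w \<in> cball 0 1" using that by simp
    with F(3) obtain z where z: "z \<in> F" "w \<in> ball z (e z)" by blast
    have "N w \<le> 2 * N z" using near z F(1) by auto
    also have "\<dots> \<le> (\<Sum>z\<in>F. 2 * N z)"
      using z F(2) N0 by (intro member_le_sum) auto
    finally show ?thesis .
  qed
  then show ?thesis using that unfolding N_def by blast
qed

text \<open>Partial fractions: this is the average over the two square roots of unity that drives
  the doubling of exponents below.\<close>

lemma cstar_inv_one_minus_square:
  fixes x :: "'a::cstar_algebra"
  assumes "cstar_invertible (1 - x)" "cstar_invertible (1 + x)"
  shows "cstar_invertible (1 - x * x)"
    and "cstar_inv (1 - x * x) = (1/2) *\<^sub>R (cstar_inv (1 - x) + cstar_inv (1 + x))"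
proof -
  have f: "1 - x * x = (1 - x) * (1 + x)" "1 - x * x = (1 + x) * (1 - x)"
    by (simp_all add: algebra_simps)
  show inv: "cstar_invertible (1 - x * x)" 
    unfolding f(1) using assms by (rule cstar_invertible_mult)
  let ?P = "cstar_inv (1 - x)" and ?Q = "cstar_inv (1 + x)"
  have "(1 - x * x) * (?P + ?Q) = (1 + x) * ((1 - x) * ?P) + (1 - x) * ((1 + x) * ?Q)"
    using f(2)[THEN arg_cong, of "\<lambda>y. y * ?P"] f(1)[THEN arg_cong, of "\<lambda>y. y * ?Q"]
    by (simp only: distrib_left[of _ ?P] mult.assoc)
  also have "\<dots> = 2 *\<^sub>R 1" using assms by (simp add: cstar_inv_simps scaleR_2)
  finally have "(1 - x * x) * ((1/2) *\<^sub>R (?P + ?Q)) = 1" by simp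
  then show "cstar_inv (1 - x * x) = (1/2) *\<^sub>R (?P + ?Q)"
    using inv by (metis cstar_inv_left_assoc mult.right_neutral)
qed

text \<open>
  Rickart's elementary argument. Averaging over square roots of unity expresses
  \<open>(1 - u k\<^sup>2\<^sup>n)\<^sup>-\<^sup>1\<close> through \<open>(1 - v k\<^sup>n)\<^sup>-\<^sup>1\<close> with \<open>v\<^sup>2 = u\<close>, so the uniform estimate comparing
  \<open>k\<close> with \<open>r k\<close> passes to all powers \<open>k ^ 2 ^ j\<close>; as \<open>(r k) ^ 2 ^ j\<close> tends to \<open>0\<close>,
  so does \<open>k ^ 2 ^ j\<close>, which contradicts the C*-identity.
\<close>

lemma selfadjoint_unit_resolvent_singular:
  fixes k :: "'a::cstar_algebra"
  assumes sa: "adj k = k" and nk: "norm k = 1"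
  shows "\<exists>z. cmod z \<le> 1 \<and> \<not> cstar_invertible (1 - z *\<^sub>C k)"
proof (rule ccontr)
  assume "\<not> ?thesis"
  then have inv: "\<And>z. cmod z \<le> 1 \<Longrightarrow> cstar_invertible (1 - z *\<^sub>C k)" by blast
  obtain D where D: "\<And>z. cmod z \<le> 1 \<Longrightarrow> norm (cstar_inv (1 - z *\<^sub>C k)) \<le> D"
    using resolvent_bounded[OF inv] by metis
  have "0 \<le> D" using order_trans[OF norm_ge_zero D[of 0]] by simp
  \<comment> \<open>This gives \<open>D * (1 - r) * D \<le> 1/8\<close>, the initial estimate of the
    induction; the summand 2 keeps \<open>r \<ge> 1/2\<close> even when
    \<open>D = 0\<close>.\<close>
  define r where "r = 1 - 1 / (8 * D\<^sup>2 + 2)"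
  have r: "0 < r" "r < 1" and rD: "D * (1 - r) * D \<le> 1/8"
    using \<open>0 \<le> D\<close> by (simp_all add: r_def divide_simps power2_eq_square add_nonneg_eq_0_iff add_nonneg_pos add_pos_nonneg)
  define p where "p j = k ^ (2 ^ j)" for j :: nat
  define \<rho> where "\<rho> j = complex_of_real (r ^ (2 ^ j))" for j :: nat
  have pSuc: "p (Suc j) = p j * p j" for j
    by (simp add: p_def power_add mult_2 flip: power2_eq_square)
  have \<rho>Suc: "\<rho> (Suc j) = \<rho> j * \<rho> j" for j
    by (simp add: \<rho>_def power_add mult_2)
  have \<rho>1: "cmod (\<rho> j) \<le> 1" for j
    using r by (simp add: \<rho>_def norm_power power_le_one)
  have np: "adj (p j) = p j \<and> norm (p j) = 1" for j
    by (induction j) (simp_all add: p_def[of 0] sa nk pSuc adj_mult norm_square_selfadjoint)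
  have main: "(\<forall>z. cmod z \<le> 1 \<longrightarrow> cstar_invertible (1 - z *\<^sub>C p j)) \<and>
      (\<forall>u. cmod u = 1 \<longrightarrow> norm (cstar_inv (1 - u *\<^sub>C p j) - cstar_inv (1 - (\<rho> j * u) *\<^sub>C p j)) \<le> 1/8)" for j
  proof (induction j)
    case 0
    have "norm (cstar_inv (1 - u *\<^sub>C k) - cstar_inv (1 - (\<rho> 0 * u) *\<^sub>C k)) \<le> 1/8" if u: "cmod u = 1" for u
    proof -
      let ?x = "1 - u *\<^sub>C k" and ?y = "1 - (\<rho> 0 * u) *\<^sub>C k"
      have ru: "cmod (\<rho> 0 * u) \<le> 1" using u \<rho>1[of 0] by (simp add: norm_mult)
      have "cstar_inv ?x - cstar_inv ?y = cstar_inv ?x * (?y - ?x) * cstar_inv ?y"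
        using inv[OF ru] inv[of u] u by (intro cstar_inv_diff) simp_all
      also have "norm \<dots> \<le> norm (cstar_inv ?x) * norm (?y - ?x) * norm (cstar_inv ?y)"
        by (meson norm_mult_ineq mult_right_mono norm_ge_zero order_trans)
      also have "norm (?y - ?x) = 1 - r"
      proof -
        have "?y - ?x = (u - \<rho> 0 * u) *\<^sub>C k" by (simp add: scaleC_diff_left)
        also have "u - \<rho> 0 * u = complex_of_real (1 - r) * u"
          by (simp add: \<rho>_def algebra_simps)
        finally show ?thesis using u nk r by (simp add: norm_scaleC norm_mult del: of_real_diff)
      qed
      also have "norm (cstar_inv ?x) * (1 - r) * norm (cstar_inv ?y) \<le> D * (1 - r) * D"
        using D[of u] D[OF ru] u r \<open>0 \<le> D\<close> by (intro mult_mono) auto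
      finally show ?thesis using rD by simp
    qed
    then show ?case using inv by (simp add: p_def)
  next
    case (Suc j)
    have step: "cstar_invertible (1 - z *\<^sub>C p (Suc j)) \<and> cstar_inv (1 - z *\<^sub>C p (Suc j)) =
        (1/2) *\<^sub>R (cstar_inv (1 - v *\<^sub>C p j) + cstar_inv (1 - (- v) *\<^sub>C p j))"
      if v: "v * v = z" "cmod v \<le> 1" for z v
    proof -
      have e: "1 + v *\<^sub>C p j = 1 - (- v) *\<^sub>C p j" by (simp add: scaleC_minus_left)
      have i: "cstar_invertible (1 - v *\<^sub>C p j)" "cstar_invertible (1 + v *\<^sub>C p j)"
        unfolding e using Suc.IH v by simp_all
      have "(v *\<^sub>C p j) * (v *\<^sub>C p j) = z *\<^sub>C p (Suc j)"
        by (simp add: pSuc mult_scaleC_left mult_scaleC_right scaleC_scaleC v)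
      then show ?thesis
        using cstar_inv_one_minus_square[OF i] by (simp only: e)
    qed
    have "cstar_invertible (1 - z *\<^sub>C p (Suc j))" if "cmod z \<le> 1" for z
      using step[of "csqrt z" z] that by (simp flip: power2_eq_square)
    moreover have "norm (cstar_inv (1 - u *\<^sub>C p (Suc j)) - cstar_inv (1 - (\<rho> (Suc j) * u) *\<^sub>C p (Suc j))) \<le> 1/8"
      if u: "cmod u = 1" for u
    proof -
      define v where "v = csqrt u"
      have v: "v * v = u" "cmod v = 1" using u by (simp_all add: v_def flip: power2_eq_square)
      have rv: "\<rho> j * v * (\<rho> j * v) = \<rho> (Suc j) * u" "cmod (\<rho> j * v) \<le> 1"
        using v \<rho>1[of j] by (auto simp: \<rho>Suc norm_mult)
      define \<delta> where "\<delta> v = cstar_inv (1 - v *\<^sub>C p j) - cstar_inv (1 - (\<rho> j * v) *\<^sub>C p j)" for v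
      have b: "norm (\<delta> v) \<le> 1/8" "norm (\<delta> (- v)) \<le> 1/8"
        \<comment> \<open>Both square roots \<open>v\<close> and \<open>- v\<close> of
          \<open>u\<close> lie on the unit circle, so the induction hypothesis applies to each and
          the average keeps the same bound 1/8.\<close>
        using Suc.IH v(2) unfolding \<delta>_def by (metis, metis norm_minus_cancel)
      have "cstar_inv (1 - u *\<^sub>C p (Suc j)) - cstar_inv (1 - (\<rho> (Suc j) * u) *\<^sub>C p (Suc j)) = (1/2) *\<^sub>R (\<delta> v + \<delta> (- v))"
        using step[OF v(1)] step[OF rv] v(2) unfolding \<delta>_def by (simp add: algebra_simps)
      also have "norm \<dots> \<le> 1/2 * (norm (\<delta> v) + norm (\<delta> (- v)))"
        using norm_triangle_ineq[of "\<delta> v" "\<delta> (- v)"] by simp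
      also have "\<dots> \<le> 1/8" using b by simp
      finally show ?thesis .
    qed
    ultimately show ?case by blast
  qed
  \<comment> \<open>With the damped term of norm at most 1/9, \<open>?w\<close> is within 1/8 of 1,
    hence \<open>?y\<close> is within 1/4 of 1. Then \<open>p j = (1 - p j) * (?y - 1)\<close> has
    norm at most 1/2, although its norm is 1.\<close>
  obtain j where j: "r ^ (2 ^ j) \<le> 1/9"
  proof -
    obtain n where "r ^ n < 1/9" using real_arch_pow_inv[of "1/9" r] r by auto
    moreover have "r ^ (2 ^ n) \<le> r ^ n" using r less_exp[of n] by (intro power_decreasing) auto
    ultimately show ?thesis using that[of n] by simp
  qed
  let ?y = "cstar_inv (1 - p j)" and ?w = "cstar_inv (1 - \<rho> j *\<^sub>C p j)"
  have iy: "cstar_invertible (1 - p j)" and iw: "cstar_invertible (1 - \<rho> j *\<^sub>C p j)"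
    using main[of j] \<rho>1[of j] by (auto dest: spec[of _ 1])
  have yw: "norm (?y - ?w) \<le> 1/8" using main[of j] by (auto dest: spec[of _ 1])
  have n1: "norm (\<rho> j *\<^sub>C p j) \<le> 1/9"
    using j r np[of j] by (simp add: \<rho>_def norm_scaleC norm_power)
  then have "norm ?w \<le> 1 / (1 - 1/9)"
    using iw by (intro norm_inv_le) auto
  then have w: "norm ?w \<le> 9/8" by simp
  have "?w - 1 = (\<rho> j *\<^sub>C p j) * ?w"
    using cstar_inv_right[OF iw] by (simp add: algebra_simps)
  then have "norm (?w - 1) \<le> 1/9 * (9/8)"
    using norm_mult_ineq[of "\<rho> j *\<^sub>C p j" ?w] mult_mono[OF n1 w] by simp
  then have y1: "norm (?y - 1) \<le> 1/4"
    using norm_triangle_ineq[of "?y - ?w" "?w - 1"] yw by simp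
  have "p j = (1 - p j) * (?y - 1)"
    using cstar_inv_right[OF iy] by (simp add: algebra_simps)
  then have "norm (p j) \<le> norm (1 - p j) * norm (?y - 1)" by (metis norm_mult_ineq)
  also have "\<dots> \<le> 2 * (1/4)"
    using y1 norm_triangle_ineq4[of 1 "p j"] np[of j] by (intro mult_mono) auto
  finally show False using np[of j] by simp
qed

text \<open>Normalise \<open>h\<close> to norm 1. A singular point \<open>z\<close> of the resolvent
  in the unit disc is nonzero, and \<open>norm h / z\<close> is then a spectral value of modulus at
  least \<open>norm h\<close>.\<close>

lemma selfadjoint_norm_le:
  fixes h :: "'a::cstar_algebra"
  assumes sa: "adj h = h" and m: "0 \<le> m" "\<And>c. c \<in> cstar_spectrum h \<Longrightarrow> cmod c \<le> m"
  shows "norm h \<le> m"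
proof (rule ccontr)
  assume n: "\<not> norm h \<le> m"
  define n where "n = norm h"
  have n0: "n > m" "n > 0" using n m(1) by (auto simp: n_def)
  define k where "k = (1/n) *\<^sub>R h"
  have "adj k = k" "norm k = 1" using sa n0 by (simp_all add: k_def) (simp add: n_def)
  then obtain z where z: "cmod z \<le> 1" "\<not> cstar_invertible (1 - z *\<^sub>C k)"
    using selfadjoint_unit_resolvent_singular by blast
  have z0: "z \<noteq> 0" using z(2) by (auto simp: cstar_invertible_def)
  define c where "c = complex_of_real n / z"
  have "c \<noteq> 0" using z0 n0 by (simp add: c_def)
  have "z *\<^sub>C k = inverse c *\<^sub>C h"
    by (simp add: k_def c_def scaleC_scaleC flip: scaleC_of_real)
  then have "1 - z *\<^sub>C k = inverse c *\<^sub>C (c *\<^sub>C 1 - h)"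
    using \<open>c \<noteq> 0\<close> by (simp add: scaleC_diff_right scaleC_scaleC)
  then have "c \<in> cstar_spectrum h"
    using z(2) cstar_invertible_scaleC[of _ "inverse c"] \<open>c \<noteq> 0\<close> by (auto simp: cstar_spectrum_def)
  then have "cmod c \<le> m" by (rule m(2))
  moreover have "n \<le> cmod c" using z(1) z0 n0 by (simp add: c_def norm_divide field_simps mult_left_le)
  ultimately show False using n0 by simp
qed

subsection \<open>Positive invertible elements\<close>

lemma spectrum_of_real_minus:
  fixes a :: "'a::cstar_algebra"
  assumes "c \<in> cstar_spectrum a"
  shows "of_real s - c \<in> cstar_spectrum (of_real s - a)"
proof -
  have "(of_real s - c) *\<^sub>C 1 - (of_real s - a) = - (c *\<^sub>C 1 - a)"
    by (simp add: scaleC_diff_left scaleC_of_real_1)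
  then show ?thesis
    using assms cstar_invertible_minus unfolding cstar_spectrum_def mem_Collect_eq
    by (metis minus_minus)
qed

text \<open>A real spectrum is positive and away from 0 exactly when it lies in an open disc of
  radius \<open>s\<close> about some \<open>s\<close>; for self-adjoint elements the norm measures
  this. The criterion turns positivity questions into norm estimates.\<close>

lemma pos_invertibles_iff:
  fixes a :: "'a::cstar_algebra"
  shows "a \<in> cstar_pos_invertibles \<longleftrightarrow> adj a = a \<and> (\<exists>s. norm (of_real s - a) < s)"
proof safe
  assume a: "a \<in> cstar_pos_invertibles"
  then show sa: "adj a = a" by (simp add: cstar_pos_invertibles_def cstar_positive_def)
  have inv: "cstar_invertible (- a)"
    using a cstar_invertible_minus by (auto simp: cstar_pos_invertibles_def)
  \<comment> \<open>By the perturbation lemma at \<open>- a\<close>, no spectral value of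
    \<open>a\<close> has modulus at most \<epsilon>. With \<open>s = norm a + \<epsilon>\<close> the
    spectrum of \<open>of_real s - a\<close> therefore lies between \<epsilon> and
    \<open>norm a\<close>.\<close>
  define \<epsilon> where "\<epsilon> = 1 / (2 * norm (cstar_inv (- a)) + 1)"
  have e0: "\<epsilon> > 0" unfolding \<epsilon>_def by (intro divide_pos_pos) (auto intro: add_nonneg_pos)
  have out: "c \<notin> cstar_spectrum a" if "cmod c \<le> \<epsilon>" for c
  proof -
    have "norm (c *\<^sub>C 1 - a - (- a)) * norm (cstar_inv (- a)) \<le> \<epsilon> * norm (cstar_inv (- a))"
      using that by (intro mult_right_mono) (auto simp: norm_scaleC)
    also have "\<dots> \<le> 1/2" by (simp add: \<epsilon>_def divide_simps add_nonneg_pos)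
    finally show ?thesis
      using cstar_invertible_near(1)[OF inv] by (simp add: cstar_spectrum_def)
  qed
  define s where "s = norm a + \<epsilon>"
  have "norm (of_real s - a) \<le> norm a"
  proof (rule selfadjoint_norm_le)
    show "adj (of_real s - a) = of_real s - a" using sa by (simp add: adj_diff)
    fix c assume "c \<in> cstar_spectrum (of_real s - a)"
    then have c: "of_real s - c \<in> cstar_spectrum a"
      using spectrum_of_real_minus[of c "of_real s - a" s] by simp
    then obtain x where x: "of_real s - c = of_real x" "0 \<le> x"
      using a by (auto simp: cstar_pos_invertibles_def cstar_positive_def elim!: nonneg_Reals_cases)
    have "x \<le> norm a" using spectrum_norm_le[OF c] x by simp
    moreover have "x > \<epsilon>" using out[of "of_real x"] c x by (cases "x \<le> \<epsilon>") auto
    moreover have "c = of_real (s - x)" using x(1) by (simp add: algebra_simps)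
    ultimately show "cmod c \<le> norm a" using e0 by (simp add: s_def del: of_real_diff of_real_add)
  qed simp
  then show "\<exists>s. norm (of_real s - a) < s"
    using e0 by (intro exI[of _ s]) (simp add: s_def)
next
  fix s assume sa: "adj a = a" and s: "norm (of_real s - a) < s"
  have pos: "Im c = 0 \<and> Re c > 0" if c: "c \<in> cstar_spectrum a" for c
  proof -
    have "Im c = 0" using selfadjoint_spectrum_real[OF sa c] .
    moreover have "cmod (of_real s - c) < s"
      using spectrum_norm_le[OF spectrum_of_real_minus[OF c, of s]] s by simp
    then have "Re (of_real s - c) < s" using complex_Re_le_cmod order_le_less_trans by blast
    ultimately show ?thesis by simp
  qed
  then have "0 \<notin> cstar_spectrum a" by force
  then have "cstar_invertible a"
    using cstar_invertible_minus[of "- a"] by (simp add: cstar_spectrum_def)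
  moreover have "cstar_spectrum a \<subseteq> \<real>\<^sub>\<ge>\<^sub>0"
    using pos by (force simp: complex_nonneg_Reals_iff)
  ultimately show "a \<in> cstar_pos_invertibles"
    using sa by (simp add: cstar_pos_invertibles_def cstar_positive_def)
qed

lemma pos_invertiblesI:
  fixes a :: "'a::cstar_algebra"
  assumes "adj a = a" "norm (of_real s - a) < s"
  shows "a \<in> cstar_pos_invertibles"
  using assms pos_invertibles_iff by blast

lemma
  assumes "a \<in> cstar_pos_invertibles"
  shows pos_invertibles_adj: "adj a = a"
    and pos_invertibles_invertible: "cstar_invertible a"
    and pos_invertibles_positive: "cstar_positive a"
  using assms by (auto simp: cstar_pos_invertibles_def cstar_positive_def)

lemma pos_invertibles_1: "1 \<in> cstar_pos_invertibles"
  by (rule pos_invertiblesI[where s = 1]) auto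

lemma pos_invertibles_add:
  assumes "a \<in> cstar_pos_invertibles" "b \<in> cstar_pos_invertibles"
  shows "a + b \<in> cstar_pos_invertibles"
proof -
  obtain s t where st: "norm (of_real s - a) < s" "norm (of_real t - b) < t"
    using assms by (auto simp: pos_invertibles_iff)
  have "norm (of_real (s + t) - (a + b)) < s + t"
    using norm_triangle_ineq[of "of_real s - a" "of_real t - b"] st by (simp add: algebra_simps)
  then show ?thesis
    by (rule pos_invertiblesI[rotated]) (use assms in \<open>simp add: pos_invertibles_iff adj_add\<close>)
qed

lemma pos_invertibles_scaleR:
  assumes "a \<in> cstar_pos_invertibles" "0 < r"
  shows "r *\<^sub>R a \<in> cstar_pos_invertibles"
proof -
  obtain s where s: "norm (of_real s - a) < s"
    using assms by (auto simp: pos_invertibles_iff)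
  have "norm (of_real (r * s) - r *\<^sub>R a) = norm (r *\<^sub>R (of_real s - a))"
    by (simp add: scaleR_diff_right of_real_def)
  also have "\<dots> < r * s"
    using s assms by simp
  finally show ?thesis
    by (rule pos_invertiblesI[rotated]) (use assms in \<open>simp add: pos_invertibles_iff\<close>)
qed

text \<open>The spectrum is already real, so only the values \<open>- t\<close> with
  \<open>t \<ge> 0\<close> have to be excluded. This suits products, where the norm criterion is
  awkward.\<close>

lemma pos_invertiblesI_shift:
  fixes a :: "'a::cstar_algebra"
  assumes sa: "adj a = a" and inv: "\<And>t. 0 \<le> t \<Longrightarrow> cstar_invertible (a + t *\<^sub>R 1)"
  shows "a \<in> cstar_pos_invertibles"
proof -
  have "c \<in> \<real>\<^sub>\<ge>\<^sub>0" if c: "c \<in> cstar_spectrum a" for c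
  proof (rule ccontr)
    assume n: "c \<notin> \<real>\<^sub>\<ge>\<^sub>0"
    have im: "Im c = 0" using selfadjoint_spectrum_real[OF sa c] .
    then have c': "c = complex_of_real (Re c)" by (simp add: complex_eq_iff)
    have "c *\<^sub>C 1 - a = - (a + (- Re c) *\<^sub>R 1)"
      by (subst c') (simp add: scaleC_of_real)
    moreover have "Re c \<le> 0" using n im by (auto simp: complex_nonneg_Reals_iff)
    then have "cstar_invertible (- (a + (- Re c) *\<^sub>R 1))"
      by (intro cstar_invertible_minus inv) simp
    ultimately have "cstar_invertible (c *\<^sub>C 1 - a)" by simp
    then show False using c by (simp add: cstar_spectrum_def)
  qed
  then show ?thesis
    using sa inv[of 0] by (auto simp: cstar_pos_invertibles_def cstar_positive_def)
qed

text \<open>Pull the shift inside: \<open>a * b * a + t\<close> equals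
  \<open>a * (b + t * cstar_inv a * cstar_inv a) * a\<close>, whose middle factor is a sum of
  positive invertible elements.\<close>

lemma pos_invertibles_conjugate:
  fixes a b :: "'a::cstar_algebra"
  assumes "adj a = a" "cstar_invertible a"
    and "cstar_inv a * cstar_inv a \<in> cstar_pos_invertibles" "b \<in> cstar_pos_invertibles"
  shows "a * b * a \<in> cstar_pos_invertibles"
proof (rule pos_invertiblesI_shift)
  show "adj (a * b * a) = a * b * a"
    using assms by (simp add: adj_mult pos_invertibles_adj mult.assoc)
  fix t :: real assume t: "0 \<le> t"
  have "b + t *\<^sub>R (cstar_inv a * cstar_inv a) \<in> cstar_pos_invertibles"
    using assms t by (cases "t = 0") (auto intro!: pos_invertibles_add pos_invertibles_scaleR simp: less_le)
  then have "cstar_invertible (a * (b + t *\<^sub>R (cstar_inv a * cstar_inv a)) * a)"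
    using assms(2) pos_invertibles_invertible by (intro cstar_invertible_mult) auto
  also have "a * (b + t *\<^sub>R (cstar_inv a * cstar_inv a)) * a = a * b * a + t *\<^sub>R 1"
    using assms(2) by (simp add: distrib_left distrib_right mult.assoc cstar_inv_simps)
  finally show "cstar_invertible (a * b * a + t *\<^sub>R 1)" .
qed

text \<open>Here the shifted element factors as
  \<open>cstar_inv a * (1 + t *\<^sub>R a)\<close>.\<close>

lemma pos_invertibles_inv:
  assumes "a \<in> cstar_pos_invertibles"
  shows "cstar_inv a \<in> cstar_pos_invertibles"
proof (rule pos_invertiblesI_shift)
  note inv = pos_invertibles_invertible[OF assms]
  show "adj (cstar_inv a) = cstar_inv a"
    using adj_cstar_inv[OF inv] pos_invertibles_adj[OF assms] by simp
  fix t :: real assume t: "0 \<le> t"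
  have "1 + t *\<^sub>R a \<in> cstar_pos_invertibles"
    using assms t by (cases "t = 0") (auto intro!: pos_invertibles_add pos_invertibles_1 pos_invertibles_scaleR simp: less_le)
  then have "cstar_invertible (cstar_inv a * (1 + t *\<^sub>R a))"
    using inv pos_invertibles_invertible by (intro cstar_invertible_mult cstar_invertible_inv) auto
  also have "cstar_inv a * (1 + t *\<^sub>R a) = cstar_inv a + t *\<^sub>R 1"
    using inv by (simp add: distrib_left cstar_inv_simps)
  finally show "cstar_invertible (cstar_inv a + t *\<^sub>R 1)" .
qed

subsection \<open>Square roots\<close>

text \<open>A square root \<open>1 - y\<close> of \<open>1 - x\<close> is a fixed point of the contraction \<open>y \<mapsto> (x + y\<^sup>2) / 2\<close>.\<close>

lemma sqrt_one_minus_exists: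
  fixes x :: "'a::cstar_algebra"
  assumes "adj x = x" "norm x < 1"
  obtains y where "adj y = y" "norm y < 1" "(1 - y) * (1 - y) = 1 - x"
    "\<And>c. c * x = x * c \<Longrightarrow> c * y = y * c"
proof -
  \<comment> \<open>All three conditions are closed and preserved by \<open>f\<close>, so the fixed
    point inherits the norm bound, self-adjointness and commutation with everything that commutes
    with \<open>x\<close>. On this set \<open>f\<close> contracts by the factor
    \<open>norm x\<close>.\<close>
  define S where "S = {y. norm y \<le> norm x} \<inter> {y. adj y = y} \<inter> (\<Inter>c\<in>{c. c * x = x * c}. {y. c * y = y * c})"
  define f where "f y = (1/2) *\<^sub>R (x + y * y)" for y
  have cont: "continuous_on UNIV (adj :: 'a \<Rightarrow> 'a)"
  proof (rule continuous_onI)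
    fix u :: 'a and e :: real assume "0 < e"
    then show "\<exists>d>0. \<forall>v\<in>UNIV. dist v u < d \<longrightarrow> dist (adj v) (adj u) \<le> e"
      by (intro exI[of _ e]) (auto simp: dist_norm simp flip: adj_diff)
  qed
  have "closed S"
    unfolding S_def
    by (intro closed_Int closed_INT ballI closed_Collect_le closed_Collect_eq cont continuous_intros)
  moreover have "x \<in> S" using assms by (auto simp: S_def)
  moreover have "f ` S \<subseteq> S"
  proof safe
    fix y assume y: "y \<in> S"
    then have ny: "norm y \<le> norm x" and sy: "adj y = y" and cy: "\<And>c. c * x = x * c \<Longrightarrow> c * y = y * c"
      by (auto simp: S_def)
    have "norm (y * y) \<le> norm x * 1"
      using norm_mult_ineq[of y y] mult_mono[OF ny, of "norm y" 1] ny assms(2) by simp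
    then have "norm (f y) \<le> norm x"
      using norm_triangle_ineq[of x "y * y"] by (simp add: f_def)
    moreover have "c * f y = f y * c" if "c * x = x * c" for c
      using that cy[OF that] by (simp add: f_def distrib_left distrib_right) (metis mult.assoc)
    ultimately show "f y \<in> S"
      using sy assms(1) by (simp add: S_def) (simp add: f_def adj_add adj_mult)
  qed
  moreover have "dist (f u) (f v) \<le> norm x * dist u v" if "u \<in> S" "v \<in> S" for u v
  proof -
    have "f u - f v = (1/2) *\<^sub>R (u * (u - v) + (u - v) * v)"
      by (simp add: f_def algebra_simps)
    then have "norm (f u - f v) \<le> 1/2 * (norm (u * (u - v)) + norm ((u - v) * v))"
      using norm_triangle_ineq[of "u * (u - v)" "(u - v) * v"] by simp
    also have "\<dots> \<le> 1/2 * (norm x * norm (u - v) + norm (u - v) * norm x)"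
      using that by (intro mult_left_mono add_mono norm_mult_ineq[THEN order_trans] mult_right_mono)
        (auto simp: S_def)
    finally show ?thesis by (simp add: dist_norm mult.commute)
  qed
  ultimately have "\<exists>!y\<in>S. f y = y"
    using assms(2) by (intro Banach_fix[of S "norm x" f]) (auto simp only: complete_eq_closed norm_ge_zero)
  then obtain y where y: "y \<in> S" "f y = y" by blast
  have "2 *\<^sub>R y = x + y * y" using y(2) unfolding f_def by (metis scaleR_half_double scaleR_2 scaleR_left_distrib scaleR_add_right)
  then have "(1 - y) * (1 - y) = 1 - x" by (simp add: algebra_simps scaleR_2)
  then show ?thesis
    using y(1) assms(2) by (intro that[of y]) (auto simp: S_def)
qed

text \<open>The norm criterion writes \<open>a\<close> as \<open>s\<close> times
  \<open>1 - x\<close> with \<open>norm x < 1\<close>. The scaled root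
  \<open>sqrt s *\<^sub>R (1 - y)\<close> meets the same criterion with centre
  \<open>sqrt s\<close>.\<close>

lemma pos_invertibles_sqrt_exists:
  fixes a :: "'a::cstar_algebra"
  assumes "a \<in> cstar_pos_invertibles"
  obtains b where "b \<in> cstar_pos_invertibles" "b * b = a"
    "\<And>c. c * a = a * c \<Longrightarrow> c * b = b * c"
proof -
  obtain s where s: "norm (of_real s - a) < s"
    using assms by (auto simp: pos_invertibles_iff)
  then have s0: "s > 0" using norm_ge_zero order_le_less_trans by blast
  define x where "x = 1 - (1/s) *\<^sub>R a"
  have a: "a = s *\<^sub>R (1 - x)" using s0 by (simp add: x_def)
  have "of_real s - a = s *\<^sub>R x" by (simp add: a scaleR_diff_right of_real_def)
  then have nx: "norm x < 1" using s s0 by simp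
  have "adj x = x" using assms by (simp add: x_def adj_diff pos_invertibles_adj)
  then obtain y where y: "adj y = y" "norm y < 1" "(1 - y) * (1 - y) = 1 - x"
    and comm: "\<And>c. c * x = x * c \<Longrightarrow> c * y = y * c"
    using sqrt_one_minus_exists nx by blast
  define b where "b = sqrt s *\<^sub>R (1 - y)"
  have "of_real (sqrt s) - b = sqrt s *\<^sub>R y" by (simp add: b_def scaleR_diff_right of_real_def)
  then have "b \<in> cstar_pos_invertibles"
    using y s0 by (intro pos_invertiblesI[where s = "sqrt s"]) (auto simp: b_def adj_diff)
  moreover have "b * b = a" using s0 by (simp add: b_def a y(3))
  moreover have "c * b = b * c" if "c * a = a * c" for c
    using comm[of c] that by (simp add: b_def x_def algebra_simps)
  ultimately show ?thesis using that by blast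
qed

text \<open>Since \<open>c\<close> commutes with its square \<open>a\<close>, it commutes with
  \<open>b\<close>, so \<open>(c + b) * (c - b) = 0\<close>. The first factor is invertible once
  \<open>c\<close> is, and \<open>c * cstar_inv a\<close> inverts \<open>c\<close>.\<close>

lemma pos_invertibles_sqrt_unique:
  fixes a b c :: "'a::cstar_algebra"
  assumes "a \<in> cstar_pos_invertibles" "b \<in> cstar_pos_invertibles" "b * b = a"
    "\<And>c. c * a = a * c \<Longrightarrow> c * b = b * c"
    and c: "cstar_positive c" "c * c = a"
  shows "c = b"
proof -
  have ca: "c * a = a * c" using c(2) by (metis mult.assoc)
  then have cb: "c * b = b * c" by (rule assms(4))
  note inv = pos_invertibles_invertible[OF assms(1)]
  have "c * cstar_inv a = cstar_inv a * c"
    using ca inv by (metis cstar_inv_left_assoc cstar_inv_right mult.assoc mult.right_neutral)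
  then have "c * cstar_inv a * c = cstar_inv a * (c * c)" by (simp add: mult.assoc)
  then have "cstar_invertible c"
    using inv by (intro cstar_invertibleI[where b = "c * cstar_inv a"])
      (simp_all add: c(2) cstar_inv_simps flip: mult.assoc[of c c])
  then have "c \<in> cstar_pos_invertibles" using c by (simp add: cstar_pos_invertibles_def)
  then have "cstar_invertible (c + b)"
    using assms(2) by (intro pos_invertibles_invertible pos_invertibles_add)
  moreover have "(c + b) * (c - b) = 0"
    using cb c(2) assms(3) by (simp add: algebra_simps)
  ultimately have "c - b = 0" by (metis cstar_inv_left_assoc mult_zero_right)
  then show ?thesis by simp
qed

lemma
  fixes a :: "'a::cstar_algebra"
  assumes "a \<in> cstar_pos_invertibles"
  shows cstar_sqrt_pos_invertible: "cstar_sqrt a \<in> cstar_pos_invertibles"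
    and cstar_sqrt_mult_self: "cstar_sqrt a * cstar_sqrt a = a"
    and cstar_sqrt_eqI: "b \<in> cstar_pos_invertibles \<Longrightarrow> b * b = a \<Longrightarrow> cstar_sqrt a = b"
proof -
  obtain d where d: "d \<in> cstar_pos_invertibles" "d * d = a" "\<And>c. c * a = a * c \<Longrightarrow> c * d = d * c"
    using pos_invertibles_sqrt_exists[OF assms] by blast
  have u: "c = d" if "cstar_positive c" "c * c = a" for c
    using pos_invertibles_sqrt_unique[OF assms d] that by blast
  have e: "cstar_sqrt a = d"
    unfolding cstar_sqrt_def
  proof (rule the_equality)
    show "cstar_positive d \<and> d * d = a" using d(2) pos_invertibles_positive[OF d(1)] by simp
  qed (rule u, simp_all)
  show "cstar_sqrt a \<in> cstar_pos_invertibles" "cstar_sqrt a * cstar_sqrt a = a"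
    using d(1,2) by (simp_all add: e)
  show "cstar_sqrt a = b" if "b \<in> cstar_pos_invertibles" "b * b = a"
    using u[OF pos_invertibles_positive[OF that(1)] that(2)] by (simp add: e)
qed

subsection \<open>The commutator equation\<close>

text \<open>A norm form of \<open>M \<ge> s - q\<close>. For the root \<open>m\<close> of
  \<open>M\<close>, the squared norm of \<open>m * x\<close> is the right side, and the squared norm
  of \<open>cstar_inv m\<close> is that of the inverse of \<open>M\<close>, at most
  \<open>1 / (s - q)\<close>.\<close>

lemma norm_congruence_lower_bound:
  fixes M x :: "'a::cstar_algebra"
  assumes M: "adj M = M" "norm (of_real s - M) \<le> q" "q < s"
  shows "(s - q) * (norm x)\<^sup>2 \<le> norm (adj x * M * x)"
proof -
  have "M \<in> cstar_pos_invertibles" using M by (intro pos_invertiblesI[where s = s]) auto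
  then obtain m where m: "m \<in> cstar_pos_invertibles" "m * m = M"
    using pos_invertibles_sqrt_exists by blast
  let ?n = "cstar_inv m"
  note im = pos_invertibles_invertible[OF m(1)]
  have iM: "cstar_invertible M" using im m(2) cstar_invertible_mult by blast
  have "?n * ?n = cstar_inv M"
    using im m(2) by (intro cstar_inv_eqI[symmetric]) (auto simp: mult.assoc cstar_inv_simps)
  moreover have "adj ?n = ?n"
    using m(1) by (intro pos_invertibles_adj pos_invertibles_inv)
  ultimately have n: "(norm ?n)\<^sup>2 \<le> 1 / (s - q)"
    using norm_square_selfadjoint[of ?n] norm_inv_le[OF iM M(2,3)] by simp
  have "norm x \<le> norm ?n * norm (m * x)"
    using norm_mult_ineq[of ?n "m * x"] im by (simp add: cstar_inv_simps)
  then have "(norm x)\<^sup>2 \<le> (norm ?n)\<^sup>2 * (norm (m * x))\<^sup>2"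
    by (metis norm_ge_zero power_mono power_mult_distrib)
  also have "\<dots> \<le> 1 / (s - q) * (norm (m * x))\<^sup>2"
    using n by (intro mult_right_mono) auto
  also have "(norm (m * x))\<^sup>2 = norm (adj x * M * x)"
    using m pos_invertibles_adj[OF m(1)] cstar_identity[of "m * x"]
    by (simp add: adj_mult mult.assoc flip: m(2))
  finally show ?thesis using M(3) by (simp add: field_simps)
qed

text \<open>Multiplying \<open>Z\<close> by the imaginary unit makes it self-adjoint, with real
  spectrum; \<open>1 - Z\<close> corresponds to the nonreal spectral parameter
  \<open>\<i>\<close>.\<close>

lemma cstar_invertible_one_minus_skew:
  fixes Z :: "'a::cstar_algebra"
  assumes "adj Z = - Z"
  shows "cstar_invertible (1 - Z)"
proof -
  have "adj (\<i> *\<^sub>C Z) = \<i> *\<^sub>C Z"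
    using assms by (simp add: adj_scaleC scaleC_minus_left scaleC_minus_right)
  then have "\<i> \<notin> cstar_spectrum (\<i> *\<^sub>C Z)"
    using selfadjoint_spectrum_real[of "\<i> *\<^sub>C Z" \<i>] by auto
  then have "cstar_invertible (inverse \<i> *\<^sub>C (\<i> *\<^sub>C 1 - \<i> *\<^sub>C Z))"
    by (intro cstar_invertible_scaleC) (auto simp: cstar_spectrum_def)
  then show ?thesis by (simp add: scaleC_diff_right scaleC_scaleC scaleC_minus_left)
qed

text \<open>
  With the Cayley transform \<open>U = (1 - Z)\<^sup>-\<^sup>1 (1 + Z)\<close>, which is unitary, and \<open>L = (1 - Z)\<^sup>-\<^sup>1 Z\<close>
  the hypothesis says \<open>U G U\<^sup>* - G = 2 L C L\<^sup>*\<close>. Since \<open>U\<close> commutes with \<open>L\<close>, iteration gives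
  \<open>U\<^sup>n G U\<^sup>-\<^sup>n - G = 2 L (\<Sum>j<n. U\<^sup>j C U\<^sup>-\<^sup>j) L\<^sup>*\<close>. The left side is bounded in \<open>n\<close>, whereas
  the norm of the right side is at least a multiple of \<open>n \<parallel>L\<parallel>\<^sup>2\<close>.
\<close>

lemma skew_commutator_eq_zero:
  fixes G Z C :: "'a::cstar_algebra"
  assumes Z: "adj Z = - Z" and C: "C \<in> cstar_pos_invertibles"
    and comm: "G * Z - Z * G = Z * C * Z"
  shows "Z = 0"
proof -
  define R where "R = cstar_inv (1 - Z)"
  define R' where "R' = cstar_inv (1 + Z)"
  have iv: "cstar_invertible (1 - Z)" "cstar_invertible (1 + Z)"
    using cstar_invertible_one_minus_skew[of Z] cstar_invertible_one_minus_skew[of "- Z"] Z by simp_all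
  have R: "(1 - Z) * R = 1" "R * (1 - Z) = 1" "(1 + Z) * R' = 1" "R' * (1 + Z) = 1"
    using iv by (simp_all add: R_def R'_def cstar_inv_simps)
  have "R * Z = R - R * (1 - Z)" "Z * R = R - (1 - Z) * R"
    "R' * Z = R' * (1 + Z) - R'" "Z * R' = (1 + Z) * R' - R'"
    by (simp_all add: algebra_simps)
  then have RZ: "R * Z = Z * R" "R' * Z = Z * R'" by (simp_all only: R)
  have adjR: "adj R = R'" using adj_cstar_inv[OF iv(1)] Z by (simp add: R_def R'_def adj_diff)
  define U where "U = R * (1 + Z)"
  define L where "L = R * Z"
  have adjU: "adj U = (1 - Z) * R'" by (simp add: U_def adj_mult adj_add adjR Z)
  have adjL: "adj L = - (Z * R')" by (simp add: L_def adj_mult adjR Z)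
  have UL: "U * L = L * U"
    unfolding U_def L_def by (simp add: distrib_left distrib_right) (metis RZ(1) mult.assoc)
  then have UL': "adj L * adj U = adj U * adj L" by (metis adj_mult)
  have "adj U * U = (1 - Z) * (R' * R) * (1 + Z)" unfolding adjU unfolding U_def by (simp only: mult.assoc)
  also have "R' * R = R * R'"
  proof -
    have "(1 + Z) * R = R * (1 + Z)" using RZ by (simp add: algebra_simps)
    then show ?thesis by (metis R(3,4) mult.assoc mult.left_neutral mult.right_neutral)
  qed
  also have "(1 - Z) * (R * R') * (1 + Z) = ((1 - Z) * R) * (R' * (1 + Z))" by (simp only: mult.assoc)
  finally have "adj U * U = 1" by (simp add: R)
  then have nU: "norm U = 1" using cstar_identity[of U] by (simp add: power2_eq_1_iff) (smt (verit) norm_ge_zero)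
  have UV: "norm (U * x * adj U) \<le> norm x" for x
    using norm_mult_ineq[of "U * x" "adj U"] norm_mult_ineq[of U x] nU by simp
  have UU: "U * adj U = 1"
  proof -
    have "U * adj U = R * ((1 + Z) * (1 - Z)) * R'" unfolding adjU unfolding U_def by (simp only: mult.assoc)
    also have "(1 + Z) * (1 - Z) = (1 - Z) * (1 + Z)" by (simp add: algebra_simps)
    also have "R * \<dots> * R' = (R * (1 - Z)) * ((1 + Z) * R')" by (simp only: mult.assoc)
    finally show ?thesis by (simp add: R)
  qed
  have UM: "U * (of_real t - M) * adj U = of_real t - U * M * adj U" for t M
    by (simp add: of_real_def left_diff_distrib right_diff_distrib UU)
  have key: "U * G * adj U - G = 2 *\<^sub>R (L * C * adj L)"
  proof -
    have "G = (R * (1 - Z)) * G * ((1 + Z) * R')" by (simp add: R)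
    also have "\<dots> = R * ((1 - Z) * G * (1 + Z)) * R'" by (simp only: mult.assoc)
    finally have "U * G * adj U - G = R * ((1 + Z) * G * (1 - Z)) * R' - R * ((1 - Z) * G * (1 + Z)) * R'"
      unfolding adjU unfolding U_def by (simp only: mult.assoc)
    also have "\<dots> = R * ((1 + Z) * G * (1 - Z) - (1 - Z) * G * (1 + Z)) * R'"
      by (simp only: left_diff_distrib right_diff_distrib)
    also have "(1 + Z) * G * (1 - Z) - (1 - Z) * G * (1 + Z) = 2 *\<^sub>R (- (G * Z - Z * G))"
      by (simp add: algebra_simps scaleR_2)
    also have "R * \<dots> * R' = 2 *\<^sub>R (L * C * adj L)"
      unfolding adjL unfolding L_def by (simp add: comm mult.assoc)
    finally show ?thesis .
  qed
  obtain s where s: "norm (of_real s - C) < s" using C by (auto simp: pos_invertibles_iff)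
  define q where "q = norm (of_real s - C)"
  \<comment> \<open>\<open>M\<close> stands for the sum of the first \<open>n\<close> conjugates of
    \<open>C\<close> and \<open>H\<close> for the \<open>n\<close>-fold conjugate of
    \<open>G\<close>. Conjugation by \<open>U\<close> fixes scalars, so each summand stays within
    \<open>q\<close> of \<open>s\<close> and the errors add up to \<open>n q\<close>.\<close>
  have iter: "\<exists>M H. adj M = M \<and> norm (of_real (real n * s) - M) \<le> real n * q \<and>
      norm H \<le> norm G \<and> H - G = 2 *\<^sub>R (L * M * adj L)" for n
  proof (induction n)
    case 0
    then show ?case by (intro exI[of _ 0] exI[of _ G]) simp
  next
    case (Suc n)
    then obtain M H where M: "adj M = M" "norm (of_real (real n * s) - M) \<le> real n * q"
      and H: "norm H \<le> norm G" "H - G = 2 *\<^sub>R (L * M * adj L)" by blast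
    define M' where "M' = U * M * adj U + C"
    have "of_real (real (Suc n) * s) - M' = U * (of_real (real n * s) - M) * adj U + (of_real s - C)"
      by (simp add: UM M'_def distrib_right del: of_real_mult)
    then have "norm (of_real (real (Suc n) * s) - M') \<le> real n * q + q"
      using norm_triangle_ineq[of "U * (of_real (real n * s) - M) * adj U" "of_real s - C"]
        UV[of "of_real (real n * s) - M"] M(2) by (simp add: q_def)
    moreover have "adj M' = M'"
      using M(1) C by (simp add: M'_def adj_add adj_mult adj_adj pos_invertibles_adj mult.assoc)
    moreover have "norm (U * H * adj U) \<le> norm G" using UV[of H] H(1) by simp
    moreover have "U * H * adj U - G = 2 *\<^sub>R (L * M' * adj L)"
    proof -
      have "U * H * adj U - G = U * (H - G) * adj U + (U * G * adj U - G)"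
        by (simp add: left_diff_distrib right_diff_distrib)
      also have "\<dots> = 2 *\<^sub>R (U * (L * M * adj L) * adj U + L * C * adj L)"
        by (simp add: H(2) key scaleR_add_right)
      also have "U * (L * M * adj L) * adj U = (U * L) * M * (adj L * adj U)" by (simp only: mult.assoc)
      also have "\<dots> = L * (U * M * adj U) * adj L" by (simp only: UL UL' mult.assoc)
      finally show ?thesis by (simp add: M'_def distrib_left distrib_right)
    qed
    ultimately show ?case by (intro exI[of _ M'] exI[of _ "U * H * adj U"]) (auto simp: algebra_simps)
  qed
  have bound: "real n * ((s - q) * (norm L)\<^sup>2) \<le> norm G" for n
  proof (cases "n = 0")
    case False
    obtain M H where M: "adj M = M" "norm (of_real (real n * s) - M) \<le> real n * q"
      and H: "norm H \<le> norm G" "H - G = 2 *\<^sub>R (L * M * adj L)" using iter by blast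
    \<comment> \<open>The lower bound is applied with \<open>x = adj L\<close> and with
      \<open>s\<close>, \<open>q\<close> scaled by \<open>n\<close>; it grows linearly while
      \<open>H - G\<close> stays bounded.\<close>
    have "(real n * s - real n * q) * (norm (adj L))\<^sup>2 \<le> norm (adj (adj L) * M * adj L)"
      using M False s by (intro norm_congruence_lower_bound) (auto simp: q_def)
    moreover have "2 * norm (L * M * adj L) \<le> norm G + norm G"
      using norm_triangle_ineq4[of H G] H by simp
    ultimately show ?thesis by (simp add: adj_adj algebra_simps)
  qed simp
  have "(s - q) * (norm L)\<^sup>2 \<le> 0"
    using reals_Archimedean3[of "(s - q) * (norm L)\<^sup>2"] bound by (meson not_less)
  then have "L = 0" using s by (simp add: q_def mult_le_0_iff)
  moreover have "(1 - Z) * L = Z" using R(1) by (simp add: L_def flip: mult.assoc)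
  ultimately show ?thesis by simp
qed

section \<open>From equality of the means to commutation\<close>

theorem theorem2p2:
  fixes A B :: "'a::cstar_algebra"
  assumes "A \<in> cstar_pos_invertibles" and "B \<in> cstar_pos_invertibles"
    and "conventional_heron_mean A B = wasserstein_mean A B"
  shows "A * B = B * A"
proof -
  define a where "a = cstar_sqrt A"
  define b where "b = cstar_sqrt B"
  define d where "d = cstar_inv a"
  define G where "G = geometric_mean (cstar_inv A) B"
  have a: "a \<in> cstar_pos_invertibles" "a * a = A"
    using assms(1) by (simp_all add: a_def cstar_sqrt_pos_invertible cstar_sqrt_mult_self)
  have b: "b \<in> cstar_pos_invertibles" "b * b = B"
    using assms(2) by (simp_all add: b_def cstar_sqrt_pos_invertible cstar_sqrt_mult_self)
  have ia: "cstar_invertible a" using a pos_invertibles_invertible by blast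
  have d: "d \<in> cstar_pos_invertibles" unfolding d_def using a(1) by (rule pos_invertibles_inv)
  have da: "d * a = 1" "a * d = 1" using ia by (simp_all add: d_def cstar_inv_simps)
  have da': "d * (a * x) = x" "a * (d * x) = x" for x by (simp_all add: da flip: mult.assoc)
  have adj: "adj a = a" "adj b = b" "adj d = d" using a b d pos_invertibles_adj by blast+
  have iA: "cstar_inv A = d * d"
    using a(2) by (intro cstar_inv_eqI) (auto simp: mult.assoc da da')
  have iAp: "cstar_inv A \<in> cstar_pos_invertibles" using assms(1) by (rule pos_invertibles_inv)
  have sq: "cstar_sqrt (cstar_inv A) = d"
    using iAp d iA by (intro cstar_sqrt_eqI) auto
  have id: "cstar_inv d = a" using da by (intro cstar_inv_eqI) auto
  \<comment> \<open>The square root of \<open>cstar_inv A\<close> is \<open>d\<close>, with inverse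
    \<open>a\<close>; hence this is the inner root in the geometric mean of
    \<open>cstar_inv A\<close> and \<open>B\<close>.\<close>
  define S where "S = cstar_sqrt (a * B * a)"
  have "a * B * a \<in> cstar_pos_invertibles"
    using ia adj iAp assms(2) iA by (intro pos_invertibles_conjugate) (auto simp: d_def)
  then have S: "adj S = S" "S * S = a * B * a"
    by (simp_all add: S_def cstar_sqrt_mult_self pos_invertibles_adj cstar_sqrt_pos_invertible)
  have G: "G = d * S * d" by (simp add: G_def geometric_mean_def sq id S_def)
  have adjG: "adj G = G" by (simp add: G adj_mult adj S mult.assoc)
  have "G * A * G = d * (S * S) * d" by (simp add: G mult.assoc da' flip: a(2))
  also have "\<dots> = B" by (simp add: S(2) mult.assoc da da')
  finally have GAG: "G * A * G = B" .
  have "(a + b) * (a + b) = A + B + A * G + G * A"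
  proof -
    have "(1/4) *\<^sub>R ((a + b) * (a + b)) = (1/4) *\<^sub>R (A + B + A * G + G * A)"
      using assms(3) unfolding conventional_heron_mean_def wasserstein_mean_def
      by (simp add: power2_eq_square a_def b_def G_def)
    then show ?thesis by simp
  qed
  then have eq: "a * b + b * a = A * G + G * A"
    using a(2) b(2) by (simp add: algebra_simps)
  define Z where "Z = a * b - A * G"
  have adjA: "adj A = A" using assms(1) by (rule pos_invertibles_adj)
  \<comment> \<open>The adjoint of \<open>a * b - A * G\<close> is \<open>b * a - G * A\<close>, so
    this second form of \<open>Z\<close> is what makes it skew-adjoint.\<close>
  have Z': "Z = G * A - b * a" using eq by (simp add: Z_def algebra_simps)
  have adjZ: "adj Z = - Z"
    by (subst (2) Z') (simp add: Z_def adj_diff adj_mult adj adjA adjG)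
  \<comment> \<open>Using one form of \<open>Z\<close> on each side lets one factor \<open>d\<close>
    cancel an \<open>a\<close> from the left and the other from the right;
    \<open>G * A * G = B\<close> then identifies the expansion with the commutator.\<close>
  have "Z * cstar_inv A * Z = (G * A - b * a) * (d * d) * (a * b - A * G)"
    by (simp only: iA) (metis Z' Z_def)
  also have "\<dots> = (G * a - b) * (b - a * G)"
    by (simp add: left_diff_distrib right_diff_distrib mult.assoc da da' flip: a(2))
  also have "\<dots> = G * (a * b) + b * a * G - G * A * G - B"
    by (simp add: algebra_simps flip: a(2) b(2))
  also have "\<dots> = G * Z - Z * G"
    by (subst (2) Z', simp add: Z_def) (simp add: algebra_simps GAG[unfolded mult.assoc])
  finally have "Z = 0"
    using skew_commutator_eq_zero[OF adjZ iAp, of G] by simp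
  then have ab: "a * b = A * G" by (simp add: Z_def)
  then have bG: "b = a * G" using da'(1) by (metis a(2) mult.assoc)
  then have "b = G * a" by (metis adj(1,2) adjG adj_mult)
  then have "a * b = b * a" using bG by (metis mult.assoc)
  then show ?thesis using a(2) b(2) by (metis mult.assoc)
qed

end
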